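(* Let $\mathcal S=\langle \omega^{\omega};\,0,\ (x,y)\mapsto x+y,\ x\mapsto \omega x\rangle$, and let $\Sigma$ be the following finite set of identities: \begin{align*} x+(y+z)&=(x+y)+z,\\ \omega(x+y)&=\omega x+\omega y,\\ x+y+\omega x&=y+\omega x,\\ x+y+z+x+t+y&=y+x+z+x+t+y,\\ x+0&=x,\\ 0+x&=x,\\ \omega 0&=0. \end{align*} Then $\Sigma$ is an axiomatization of the equational theory of $\mathcal S$. That is, every identity of $\Sigma$ is satisfied in $\mathcal S$, and for all terms $E,F$, if $E$ and $F$ are equivalent in $\mathcal S$, then the identity $E=F$ is derivable from $\Sigma$ by the rules of equational logic.
   Context: The universe $\omega^\omega$ is the set of all ordinals less than $\omega^{\omega}$ (ordinal exponentiation), $+$ is ordinal addition, and $\omega x$ is the ordinal product $\omega\cdot x$ (left multiplication by $\omega$), so that $\omega\cdot\omega^{\alpha}=\omega^{1+\alpha}$ and $\omega(x+y)=\omega x+\omega y$. Terms: fix a countably infinite set $X$ of variables. Variables and the constant $0$ are terms; if $E,F$ are terms then $E+F$ and $\omega E$ are terms. Unparenthesized sums are bracketed to the left. Two terms $E,F$ are equivalent in $\mathcal S$ if they define the same function of their variables (for a common finite list of variables $x_1,\dots,x_n$ containing all those occurring in $E$ or $F$, the same function $(\omega^{\omega})^n\to\omega^{\omega}$). An identity $E=F$ is satisfied in $\mathcal S$ if $E$ and $F$ are equivalent in $\mathcal S$. The rules of equational logic are reflexivity, symmetry, transitivity, substitution of terms for variables, and congruence with respect to $+$ and $x\mapsto\omega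 x$. *)

theory Defs
  imports "HOL-Library.Countable_Set"
begin

text \<open>
  Ordinals are order types of well-orders. Order types of well-orders on sets of natural numbers
  are exactly the countable ordinals; they include everything up to \<open>\<omega>\<^sup>\<omega>\<close> and beyond. Well-orders
  are reflexive relations, as in the library, and \<open>Field r\<close> may be empty (order type \<open>0\<close>).
\<close>

quotient_type countable_ord = "nat rel" / partial: "\<lambda>r s. (r, s) \<in> ordIso"
proof (rule part_equivpI)
  show "\<exists>r. (r :: nat rel, r) \<in> ordIso"
    using natLeq_Well_order ordIso_reflexive by blast
  show "symp (\<lambda>r s. (r :: nat rel, s) \<in> ordIso)"
    by (rule sympI) (rule ordIso_symmetric)
  show "transp (\<lambda>r s. (r :: nat rel, s) \<in> ordIso)"
    by (rule transpI) (rule ordIso_transitive)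
qed

instantiation countable_ord :: wellorder
begin

lift_definition less_eq_countable_ord :: "countable_ord \<Rightarrow> countable_ord \<Rightarrow> bool"
  is "\<lambda>r s. (r, s) \<in> ordLeq"
  by (meson ordIso_ordLeq_trans ordIso_symmetric ordLeq_ordIso_trans)

lift_definition less_countable_ord :: "countable_ord \<Rightarrow> countable_ord \<Rightarrow> bool"
  is "\<lambda>r s. (r, s) \<in> ordLess"
  by (meson ordIso_ordLess_trans ordIso_symmetric ordLess_ordIso_trans)

instance
proof
  fix x y z :: countable_ord
  have W: "Well_order r" if "(r :: nat rel, r) \<in> ordIso" for r
    using that by (simp add: ordIso_def)
  show "(x < y) = (x \<le> y \<and> \<not> y \<le> x)"
    by transfer (metis W not_ordLeq_iff_ordLess ordLess_imp_ordLeq)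
  show "x \<le> x"
    by transfer (use W ordLeq_reflexive in blast)
  show "x \<le> y \<Longrightarrow> y \<le> z \<Longrightarrow> x \<le> z"
    by transfer (rule ordLeq_transitive)
  show "x \<le> y \<Longrightarrow> y \<le> x \<Longrightarrow> x = y"
    by transfer (simp add: ordIso_iff_ordLeq)
  show "x \<le> y \<or> y \<le> x"
    by transfer (use W ordLeq_total in blast)
next
  fix P :: "countable_ord \<Rightarrow> bool" and a
  assume step: "\<And>x. (\<And>y. y < x \<Longrightarrow> P y) \<Longrightarrow> P x"
  have "\<forall>x. rep_countable_ord x = r \<longrightarrow> P x" for r
  proof (induction r rule: wf_induct[OF wf_ordLess])
    case (1 r)
    show ?case
    proof (intro allI impI)
      fix x assume x: "rep_countable_ord x = r"
      show "P x"
      proof (rule step)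
        fix y assume "y < x"
        then have "(rep_countable_ord y, r) \<in> ordLess"
          using x by (simp add: less_countable_ord_def)
        then show "P y" using 1 by blast
      qed
    qed
  qed
  then show "P a" by blast
qed

end

text \<open>Meaningful only for a well-order with countable field, see \<open>order_type_eq_iff\<close> below.\<close>

definition order_type :: "'a rel \<Rightarrow> countable_ord" where
  "order_type r = abs_countable_ord (SOME s. (s, r) \<in> ordIso)"

lemma countable_Well_order_nat_copy:
  assumes "Well_order r" and "countable (Field r)"
  shows "\<exists>s :: nat rel. (s, r) \<in> ordIso"
proof -
  have "(r, dir_image r (to_nat_on (Field r))) \<in> ordIso"
    using assms by (intro dir_image_ordIso) auto
  then show ?thesis using ordIso_symmetric by blast
qed

lemma order_type_eq_iff:
  assumes "Well_order r" "countable (Field r)" "Well_order s" "countable (Field s)"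
  shows "order_type r = order_type s \<longleftrightarrow> (r, s) \<in> ordIso"
proof -
  define r' s' where "r' = (SOME t :: nat rel. (t, r) \<in> ordIso)"
    and "s' = (SOME t :: nat rel. (t, s) \<in> ordIso)"
  have r': "(r', r) \<in> ordIso" and s': "(s', s) \<in> ordIso"
    unfolding r'_def s'_def using assms countable_Well_order_nat_copy by (metis someI_ex)+
  have "(r', r') \<in> ordIso" "(s', s') \<in> ordIso"
    using r' s' ordIso_symmetric ordIso_transitive by blast+
  then have "order_type r = order_type s \<longleftrightarrow> (r', s') \<in> ordIso"
    unfolding order_type_def r'_def[symmetric] s'_def[symmetric]
    using Quotient3_rel[OF Quotient3_countable_ord, of r' s'] by auto
  also have "\<dots> \<longleftrightarrow> (r, s) \<in> ordIso"
    using r' s' ordIso_symmetric ordIso_transitive by metis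
  finally show ?thesis .
qed

text \<open>Ordered sum: all of \<open>r\<close> comes before all of \<open>s\<close>.\<close>

definition order_sum :: "'a rel \<Rightarrow> 'b rel \<Rightarrow> ('a + 'b) rel" where
  "order_sum r s =
     {(Inl a, Inl a') | a a'. (a, a') \<in> r} \<union>
     {(Inr b, Inr b') | b b'. (b, b') \<in> s} \<union>
     {(Inl a, Inr b) | a b. a \<in> Field r \<and> b \<in> Field s}"

text \<open>Ordered product: \<open>s\<close>-many copies of \<open>r\<close>, so the second component is the more significant one.\<close>

definition order_prod :: "'a rel \<Rightarrow> 'b rel \<Rightarrow> ('a \<times> 'b) rel" where
  "order_prod r s =
     {((a, b), (a', b')) | a b a' b'.
        a \<in> Field r \<and> a' \<in> Field r \<and> b \<in> Field s \<and> b' \<in> Field s \<and>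
        (b \<noteq> b' \<and> (b, b') \<in> s \<or> b = b' \<and> (a, a') \<in> r)}"

instantiation countable_ord :: "{zero, one, plus, times}"
begin

definition zero_countable_ord :: countable_ord where
  "0 = order_type ({} :: nat rel)"

definition one_countable_ord :: countable_ord where
  "1 = order_type {(0 :: nat, 0 :: nat)}"

definition plus_countable_ord :: "countable_ord \<Rightarrow> countable_ord \<Rightarrow> countable_ord" where
  "x + y = order_type (order_sum (rep_countable_ord x) (rep_countable_ord y))"

definition times_countable_ord :: "countable_ord \<Rightarrow> countable_ord \<Rightarrow> countable_ord" where
  "x * y = order_type (order_prod (rep_countable_ord x) (rep_countable_ord y))"

instance ..

end

definition omega :: countable_ord  (\<open>\<omega>\<close>) where
  "\<omega> = order_type natLeq"

text \<open>
  Exponentiation to base \<open>\<omega>\<close> by transfinite recursion: the supremum of \<open>1\<close> and all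
  \<open>\<omega>\<^sup>\<gamma> \<cdot> \<omega>\<close> with \<open>\<gamma> < \<beta>\<close>. This merges the usual three clauses for zero, successors and limits.
\<close>

function omega_power :: "countable_ord \<Rightarrow> countable_ord" where
  "omega_power \<beta> = (LEAST \<delta>. 1 \<le> \<delta> \<and> (\<forall>\<gamma>. \<gamma> < \<beta> \<longrightarrow> omega_power \<gamma> * \<omega> \<le> \<delta>))"
  by auto
termination
  by (relation "{(x, y). x < y}") (auto intro: wf)

declare omega_power.simps [simp del]

datatype trm = Var nat | Zero | Plus trm trm (infixl \<open>\<oplus>\<close> 65) | Omega_Times trm

definition universe :: "countable_ord set" where
  "universe = {x. x < omega_power \<omega>}"

primrec eval_trm :: "(nat \<Rightarrow> countable_ord) \<Rightarrow> trm \<Rightarrow> countable_ord" where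
  "eval_trm v (Var i) = v i"
| "eval_trm v Zero = 0"
| "eval_trm v (E \<oplus> F) = eval_trm v E + eval_trm v F"
| "eval_trm v (Omega_Times E) = \<omega> * eval_trm v E"

text \<open>
  Assignments range over all variables; only those occurring in a term affect its value, so this
  is equality of the term functions in any common list of variables.
\<close>

definition equivalent :: "trm \<Rightarrow> trm \<Rightarrow> bool" where
  "equivalent E F \<longleftrightarrow> (\<forall>v. range v \<subseteq> universe \<longrightarrow> eval_trm v E = eval_trm v F)"

type_synonym identity = "trm \<times> trm"

definition satisfied :: "identity \<Rightarrow> bool" where
  "satisfied e \<longleftrightarrow> equivalent (fst e) (snd e)"

primrec subst_trm :: "(nat \<Rightarrow> trm) \<Rightarrow> trm \<Rightarrow> trm" where
  "subst_trm \<sigma> (Var i) = \<sigma> i"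
| "subst_trm \<sigma> Zero = Zero"
| "subst_trm \<sigma> (E \<oplus> F) = subst_trm \<sigma> E \<oplus> subst_trm \<sigma> F"
| "subst_trm \<sigma> (Omega_Times E) = Omega_Times (subst_trm \<sigma> E)"

inductive derivable :: "identity set \<Rightarrow> identity \<Rightarrow> bool" for A :: "identity set" where
  axiom: "e \<in> A \<Longrightarrow> derivable A e"
| refl: "derivable A (E, E)"
| sym: "derivable A (E, F) \<Longrightarrow> derivable A (F, E)"
| trans: "derivable A (E, F) \<Longrightarrow> derivable A (F, G) \<Longrightarrow> derivable A (E, G)"
| subst: "derivable A (E, F) \<Longrightarrow> derivable A (subst_trm \<sigma> E, subst_trm \<sigma> F)"
| cong_Plus: "derivable A (E, F) \<Longrightarrow> derivable A (E', F') \<Longrightarrow> derivable A (E \<oplus> E', F \<oplus> F')"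
| cong_Omega_Times: "derivable A (E, F) \<Longrightarrow> derivable A (Omega_Times E, Omega_Times F)"

definition Sigma_identities :: "identity set" where
  "Sigma_identities =
     (let x = Var 0; y = Var 1; z = Var 2; t = Var 3 in
       {(x \<oplus> (y \<oplus> z), (x \<oplus> y) \<oplus> z),
        (Omega_Times (x \<oplus> y), Omega_Times x \<oplus> Omega_Times y),
        (x \<oplus> y \<oplus> Omega_Times x, y \<oplus> Omega_Times x),
        (x \<oplus> y \<oplus> z \<oplus> x \<oplus> t \<oplus> y, y \<oplus> x \<oplus> z \<oplus> x \<oplus> t \<oplus> y),
        (x \<oplus> Zero, x),
        (Zero \<oplus> x, x),
        (Omega_Times Zero, Zero)})"

end

theory Submission
  imports Defs "HOL-Library.Multiset_Order"
begin

text \<open>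
  An ordinal below \<open>\<omega>\<^sup>\<omega>\<close> is given by its Cantor normal form, a finite multiset of exponents. The
  ordinal order is the multiset order, addition erases from the left operand all exponents that
  are exceeded on the right (\<open>\<boxplus>\<close>), and left multiplication by \<open>\<omega>\<close> raises all exponents by one.
  The lemmas \<open>ord_of_plus\<close>, \<open>omega_times_ord_of\<close> and \<open>universe_eq\<close> establish this isomorphism for
  order types of well-orders. The identities then hold because both sides have the same
  coefficients.

  For completeness, distributivity turns a term into a word in the letters \<open>\<omega>\<^sup>k x\<^sub>i\<close>. The third
  identity, iterated, allows one to delete a letter \<open>\<omega>\<^sup>k x\<^sub>i\<close> that is followed, at any distance, by some
  \<open>\<omega>\<^sup>m x\<^sub>i\<close> with \<open>m > k\<close> (\<open>absorb_letter\<close>), so that only reduced words remain. The fourth one allows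
  one to swap adjacent letters that both occur again later (\<open>swap_letters\<close>). Modulo such swaps, a
  word amounts to the order in which its letters occur for the last time, together with the
  multiset of letters between any two consecutive last occurrences. All this is determined by the
  number of occurrences of each letter, in total and after the last occurrence of each other letter
  (\<open>word_value_eqI\<close>).

  For reduced words these numbers can be recovered from values in the structure. To count the
  letters \<open>\<omega>\<^sup>k x\<close> after the last \<open>\<omega>\<^sup>m y\<close>, give \<open>x\<close> and \<open>y\<close> multiples of powers of \<open>\<omega>\<close> for which \<open>\<omega>\<^sup>m y\<close> has a
  degree larger by one than \<open>\<omega>\<^sup>k x\<close>, and zero to all other variables: the last \<open>\<omega>\<^sup>m y\<close> erases all
  earlier \<open>\<omega>\<^sup>k x\<close>, and the later ones show up in a coefficient of the sum
  (\<open>tail_count_determined\<close>). Hence equivalent terms have reduced words that differ only by swaps.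
\<close>

section \<open>Order types of well-ordered sets\<close>

definition le_on :: "'a::wellorder set \<Rightarrow> 'a rel" where
  "le_on A = {(x, y). x \<in> A \<and> y \<in> A \<and> x \<le> y}"

text \<open>
  The order type of a set in its given well-order. Every ordinal computation below is an
  isomorphism between such sets, which avoids handling representative relations afterwards.
\<close>

definition set_type :: "'a::wellorder set \<Rightarrow> countable_ord" where
  "set_type A = order_type (le_on A)"

lemma Field_le_on [simp]: "Field (le_on A) = A"
  by (auto simp: le_on_def Field_def)

lemma in_le_on_iff [simp]: "(x, y) \<in> le_on A \<longleftrightarrow> x \<in> A \<and> y \<in> A \<and> x \<le> y"
  by (simp add: le_on_def)

lemma Well_order_le_on: "Well_order (le_on A)"
proof -
  have "wf (le_on A - Id)"
    by (rule wf_subset[OF wf]) (auto simp: le_on_def)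
  moreover have "Linear_order (le_on A)"
    by (auto simp: le_on_def order_on_defs refl_on_def trans_def antisym_def total_on_def Field_def)
  ultimately show ?thesis by (simp add: well_order_on_def)
qed

text \<open>
  The relation \<open>r\<close> is the image of the order on \<open>A\<close> under the inverse of \<open>g\<close>, and hence a
  well-order. Ordered sums and products thus inherit well-foundedness from a known set.
\<close>

lemma order_type_eq_set_type:
  assumes g: "bij_betw g (Field r) A" and A: "countable A"
    and ord: "\<And>a b. a \<in> Field r \<Longrightarrow> b \<in> Field r \<Longrightarrow> (a, b) \<in> r \<longleftrightarrow> g a \<le> g b"
  shows "order_type r = set_type A"
proof -
  define f where "f = inv_into (Field r) g"
  have f: "bij_betw f A (Field r)" unfolding f_def by (rule bij_betw_inv_into[OF g])
  have gf: "g (f a) = a" if "a \<in> A" for a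
    unfolding f_def using g that by (simp add: bij_betw_def f_inv_into_f)
  have fg: "f (g a) = a" if "a \<in> Field r" for a
    unfolding f_def using g that by (simp add: bij_betw_def)
  have "r = dir_image (le_on A) f"
  proof (intro set_eqI, clarify)
    fix a b
    show "(a, b) \<in> r \<longleftrightarrow> (a, b) \<in> dir_image (le_on A) f" (is "_ \<longleftrightarrow> ?R")
    proof
      assume ab: "(a, b) \<in> r"
      then have F: "a \<in> Field r" "b \<in> Field r" by (auto simp: Field_def)
      then have "g a \<in> A" "g b \<in> A" "g a \<le> g b" using g ord ab by (auto simp: bij_betw_def)
      then have "(f (g a), f (g b)) \<in> dir_image (le_on A) f"
        by (auto simp: dir_image_def le_on_def)
      then show ?R using F fg by simp
    next
      assume ?R
      then obtain x y where xy: "x \<in> A" "y \<in> A" "x \<le> y" "a = f x" "b = f y"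
        by (auto simp: dir_image_def le_on_def)
      then have "f x \<in> Field r" "f y \<in> Field r" using f by (auto simp: bij_betw_def)
      then show "(a, b) \<in> r" using xy ord gf by simp
    qed
  qed
  moreover have "(le_on A, dir_image (le_on A) f) \<in> ordIso"
    using f by (intro dir_image_ordIso Well_order_le_on) (auto simp: bij_betw_def)
  ultimately have iso: "(le_on A, r) \<in> ordIso" by simp
  then have "Well_order r" by (simp add: ordIso_def)
  moreover have "countable (Field r)" using f A by (metis bij_betw_def countable_image)
  ultimately show ?thesis unfolding set_type_def
    using iso A by (metis Field_le_on Well_order_le_on order_type_eq_iff)
qed

lemma rep_set_type_ordIso:
  assumes "countable A"
  shows "(rep_countable_ord (set_type A), le_on A) \<in> ordIso"
proof -
  define s where "s = (SOME s :: nat rel. (s, le_on A) \<in> ordIso)"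
  have s: "(s, le_on A) \<in> ordIso"
    unfolding s_def
    by (rule someI_ex, rule countable_Well_order_nat_copy[OF Well_order_le_on]) (simp add: assms)
  then have "(s, s) \<in> ordIso" using ordIso_symmetric ordIso_transitive by blast
  then have "(rep_countable_ord (abs_countable_ord s), s) \<in> ordIso"
    using Quotient3_rep_abs[OF Quotient3_countable_ord] by blast
  then show ?thesis using s ordIso_transitive
    unfolding set_type_def order_type_def s_def by blast
qed

lemma rep_set_type:
  assumes "countable A"
  obtains f where "bij_betw f (Field (rep_countable_ord (set_type A))) A"
    and "\<And>a b. a \<in> Field (rep_countable_ord (set_type A)) \<Longrightarrow>
           b \<in> Field (rep_countable_ord (set_type A)) \<Longrightarrow>
           (a, b) \<in> rep_countable_ord (set_type A) \<longleftrightarrow> f a \<le> f b"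
proof -
  let ?r = "rep_countable_ord (set_type A)"
  from rep_set_type_ordIso[OF assms] obtain f where f: "iso ?r (le_on A) f"
    by (auto simp: ordIso_def)
  then have bij: "bij_betw f (Field ?r) A"
    and ord: "\<forall>a \<in> Field ?r. \<forall>b \<in> Field ?r. (a, b) \<in> ?r \<longleftrightarrow> (f a, f b) \<in> le_on A"
    by (auto simp: iso_iff2)
  show ?thesis
  proof (rule that[OF bij])
    fix a b assume "a \<in> Field ?r" "b \<in> Field ?r"
    then show "(a, b) \<in> ?r \<longleftrightarrow> f a \<le> f b"
      using ord bij by (auto simp: le_on_def bij_betw_def)
  qed
qed

text \<open>
  An ordinal sum is recognized by splitting a well-ordered set into an initial copy of one
  summand followed by a copy of the other.
\<close>

lemma set_type_plus:
  assumes cA: "countable A" and cB: "countable B" and cC: "countable C"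
    and C: "C = p ` A \<union> q ` B"
    and p: "strict_mono_on A p" and q: "strict_mono_on B q"
    and pq: "\<And>a b. a \<in> A \<Longrightarrow> b \<in> B \<Longrightarrow> p a < q b"
  shows "set_type A + set_type B = set_type C"
proof -
  let ?r = "rep_countable_ord (set_type A)" and ?s = "rep_countable_ord (set_type B)"
  obtain f where f: "bij_betw f (Field ?r) A"
      "\<And>a b. a \<in> Field ?r \<Longrightarrow> b \<in> Field ?r \<Longrightarrow> (a, b) \<in> ?r \<longleftrightarrow> f a \<le> f b"
    using rep_set_type[OF cA] by blast
  obtain g where g: "bij_betw g (Field ?s) B"
      "\<And>a b. a \<in> Field ?s \<Longrightarrow> b \<in> Field ?s \<Longrightarrow> (a, b) \<in> ?s \<longleftrightarrow> g a \<le> g b"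
    using rep_set_type[OF cB] by blast
  have F: "Field (order_sum ?r ?s) = Inl ` Field ?r \<union> Inr ` Field ?s"
  proof
    have "(Inl a, Inl a) \<in> order_sum ?r ?s" if "a \<in> Field ?r" for a
      using that f(2) by (simp add: order_sum_def)
    moreover have "(Inr b, Inr b) \<in> order_sum ?r ?s" if "b \<in> Field ?s" for b
      using that g(2) by (simp add: order_sum_def)
    ultimately show "Inl ` Field ?r \<union> Inr ` Field ?s \<subseteq> Field (order_sum ?r ?s)"
      by (auto intro: FieldI1)
  qed (auto simp: order_sum_def Field_def)
  have fA: "f a \<in> A" if "a \<in> Field ?r" for a using f(1) that by (auto simp: bij_betw_def)
  have gB: "g b \<in> B" if "b \<in> Field ?s" for b using g(1) that by (auto simp: bij_betw_def)
  have qp: "\<not> q (g b) \<le> p (f a)" if "a \<in> Field ?r" "b \<in> Field ?s" for a b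
    using pq[OF fA gB] that by (simp add: not_le)
  let ?h = "case_sum (p \<circ> f) (q \<circ> g)"
  have ord: "(a, b) \<in> order_sum ?r ?s \<longleftrightarrow> ?h a \<le> ?h b"
    if "a \<in> Field (order_sum ?r ?s)" "b \<in> Field (order_sum ?r ?s)" for a b
    using that unfolding F
    by (auto simp: order_sum_def f(2) g(2) fA gB pq less_imp_le qp
        strict_mono_on_less_eq[OF p] strict_mono_on_less_eq[OF q])
  have "?h ` Field (order_sum ?r ?s) = p ` f ` Field ?r \<union> q ` g ` Field ?s"
    unfolding F by (simp add: image_Un image_image)
  also have "\<dots> = C" using f(1) g(1) by (simp add: C bij_betw_def)
  finally have im: "?h ` Field (order_sum ?r ?s) = C" .
  have "inj_on ?h (Field (order_sum ?r ?s))"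
    unfolding F
    using f(1) g(1) fA gB pq strict_mono_on_eqD[OF p] strict_mono_on_eqD[OF q]
    by (auto simp: inj_on_def bij_betw_def) (metis less_irrefl)+
  with im have "bij_betw ?h (Field (order_sum ?r ?s)) C" by (simp add: bij_betw_def)
  then show ?thesis unfolding plus_countable_ord_def
    by (rule order_type_eq_set_type) (use cC ord in auto)
qed

text \<open>
  An ordinal product is recognized by a bijection from pairs that is increasing for the order in
  which the second component is the more significant one.
\<close>

lemma set_type_times:
  assumes cA: "countable A" and cB: "countable B" and cC: "countable C"
    and C: "C = (\<lambda>(a, b). h a b) ` (A \<times> B)"
    and h: "\<And>a b a' b'. a \<in> A \<Longrightarrow> b \<in> B \<Longrightarrow> a' \<in> A \<Longrightarrow> b' \<in> B \<Longrightarrow>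
              b < b' \<or> b = b' \<and> a < a' \<Longrightarrow> h a b < h a' b'"
  shows "set_type A * set_type B = set_type C"
proof -
  let ?r = "rep_countable_ord (set_type A)" and ?s = "rep_countable_ord (set_type B)"
  obtain f where f: "bij_betw f (Field ?r) A"
      "\<And>a b. a \<in> Field ?r \<Longrightarrow> b \<in> Field ?r \<Longrightarrow> (a, b) \<in> ?r \<longleftrightarrow> f a \<le> f b"
    using rep_set_type[OF cA] by blast
  obtain g where g: "bij_betw g (Field ?s) B"
      "\<And>a b. a \<in> Field ?s \<Longrightarrow> b \<in> Field ?s \<Longrightarrow> (a, b) \<in> ?s \<longleftrightarrow> g a \<le> g b"
    using rep_set_type[OF cB] by blast
  have h_le: "h a b \<le> h a' b' \<longleftrightarrow> b < b' \<or> b = b' \<and> a \<le> a'"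
    if "a \<in> A" "b \<in> B" "a' \<in> A" "b' \<in> B" for a b a' b'
    using h[OF that] h[OF that(3,4,1,2)]
    by (metis less_le_not_le linorder_less_linear order.order_iff_strict)
  have F: "Field (order_prod ?r ?s) = Field ?r \<times> Field ?s"
  proof
    have "((a, b), (a, b)) \<in> order_prod ?r ?s" if "a \<in> Field ?r" "b \<in> Field ?s" for a b
      using that unfolding order_prod_def by (auto simp: f(2))
    then show "Field ?r \<times> Field ?s \<subseteq> Field (order_prod ?r ?s)"
      by (auto intro: FieldI1)
  qed (auto simp: order_prod_def Field_def)
  have fA: "f a \<in> A" if "a \<in> Field ?r" for a using f(1) that by (auto simp: bij_betw_def)
  have gB: "g b \<in> B" if "b \<in> Field ?s" for b using g(1) that by (auto simp: bij_betw_def)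
  have ginj: "g b = g b' \<longleftrightarrow> b = b'" if "b \<in> Field ?s" "b' \<in> Field ?s" for b b'
    using g(1) that by (auto simp: bij_betw_def inj_on_def)
  have finj: "f b = f b' \<longleftrightarrow> b = b'" if "b \<in> Field ?r" "b' \<in> Field ?r" for b b'
    using f(1) that by (auto simp: bij_betw_def inj_on_def)
  let ?h = "\<lambda>(a, b). h (f a) (g b)"
  have ord: "(a, b) \<in> order_prod ?r ?s \<longleftrightarrow> ?h a \<le> ?h b"
    if "a \<in> Field (order_prod ?r ?s)" "b \<in> Field (order_prod ?r ?s)" for a b
    using that unfolding F
    by (auto simp: order_prod_def h_le fA gB f(2) g(2) ginj less_le)
  have "?h ` Field (order_prod ?r ?s) = (\<lambda>(a, b). h a b) ` (f ` Field ?r \<times> g ` Field ?s)"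
    unfolding F by (auto simp: image_iff)
  also have "\<dots> = C" using f(1) g(1) by (simp add: C bij_betw_def)
  finally have im: "?h ` Field (order_prod ?r ?s) = C" .
  have "inj_on ?h (Field (order_prod ?r ?s))"
  proof (rule inj_onI, clarify)
    fix a b a' b'
    assume F': "(a, b) \<in> Field (order_prod ?r ?s)" "(a', b') \<in> Field (order_prod ?r ?s)"
      and eq: "h (f a) (g b) = h (f a') (g b')"
    then show "a = a' \<and> b = b'"
      using h_le[of "f a" "g b" "f a'" "g b'"] h_le[of "f a'" "g b'" "f a" "g b"] fA gB
      unfolding F by (auto simp: ginj finj)
  qed
  with im have "bij_betw ?h (Field (order_prod ?r ?s)) C" by (simp add: bij_betw_def)
  then show ?thesis unfolding times_countable_ord_def
    by (rule order_type_eq_set_type) (use cC ord in auto)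
qed

lemma less_set_type_iff:
  assumes "countable A"
  shows "x < set_type A \<longleftrightarrow> (\<exists>a \<in> A. x = set_type {b \<in> A. b < a})"
proof -
  let ?r = "rep_countable_ord (set_type A)"
  have restr: "Restr (le_on A) (underS (le_on A) a) = le_on {b \<in> A. b < a}" if "a \<in> A" for a
    using that by (auto simp: le_on_def underS_def)
  have refl: "(rep_countable_ord x, rep_countable_ord x) \<in> ordIso" for x
    using Quotient3_rep_reflp[OF Quotient3_countable_ord] .
  have W: "Well_order (rep_countable_ord x)" for x
    using refl by (simp add: ordIso_def)
  have iso: "(rep_countable_ord x, le_on B) \<in> ordIso \<longleftrightarrow> x = set_type B" if "countable B" for B :: "'a set"
  proof
    assume "(rep_countable_ord x, le_on B) \<in> ordIso"
    then have "(rep_countable_ord x, rep_countable_ord (set_type B)) \<in> ordIso"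
      using rep_set_type_ordIso[OF that] ordIso_symmetric ordIso_transitive by blast
    then show "x = set_type B"
      using Quotient3_rel_rep[OF Quotient3_countable_ord] by blast
  qed (use rep_set_type_ordIso[OF that] in simp)
  have "x < set_type A \<longleftrightarrow> (rep_countable_ord x, ?r) \<in> ordLess"
    by (simp add: less_countable_ord_def)
  also have "\<dots> \<longleftrightarrow> (rep_countable_ord x, le_on A) \<in> ordLess"
    using rep_set_type_ordIso[OF assms] by (metis ordIso_symmetric ordLess_ordIso_trans)
  also have "\<dots> \<longleftrightarrow> (\<exists>a \<in> A. (rep_countable_ord x, le_on {b \<in> A. b < a}) \<in> ordIso)"
    by (simp add: ordLess_iff_ordIso_Restr[OF Well_order_le_on W] restr)
  also have "\<dots> \<longleftrightarrow> (\<exists>a \<in> A. x = set_type {b \<in> A. b < a})"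
    using assms by (simp add: iso)
  finally show ?thesis .
qed

section \<open>Cantor normal forms as multisets\<close>

text \<open>
  The multiset order compares Cantor normal forms: the largest exponent at which the coefficients
  differ decides.
\<close>

lemma less_mset_nat_iff:
  "(M :: nat multiset) < N \<longleftrightarrow> (\<exists>i. count M i < count N i \<and> (\<forall>j>i. count M j = count N j))"
    (is "_ \<longleftrightarrow> ?lex")
proof
  assume less: "M < N"
  define D where "D = {i. count M i \<noteq> count N i}"
  have "D \<subseteq> set_mset M \<union> set_mset N"
    unfolding D_def by (auto simp: not_in_iff)
  then have fin: "finite D" using finite_subset by blast
  have "D \<noteq> {}" using less multiset_eqI[of M N] unfolding D_def by blast
  then have "count M (Max D) \<noteq> count N (Max D)" using fin Max_in[of D] D_def by blast
  moreover have above: "\<forall>j>Max D. count M j = count N j"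
    using Max_ge[OF fin] leD D_def by blast
  moreover have "count N (Max D) < count M (Max D) \<longrightarrow> (\<exists>j>Max D. count M j < count N j)"
    using less less_multiset\<^sub>H\<^sub>O by blast
  ultimately have "count M (Max D) < count N (Max D)" by (metis less_irrefl nat_neq_iff)
  then show ?lex using above by blast
next
  assume ?lex
  then obtain i where "count M i < count N i" "\<forall>j>i. count M j = count N j" by blast
  then show "M < N"
    unfolding less_multiset\<^sub>H\<^sub>O by (metis less_irrefl linorder_neqE_nat less_imp_not_less)
qed

lemma less_mset_natI:
  assumes "count M i < count N i" and "\<And>j. i < j \<Longrightarrow> count M j = count N j"
  shows "(M :: nat multiset) < N"
  using assms less_mset_nat_iff by blast

lemma less_mset_single_iff: "K < {#n::nat#} \<longleftrightarrow> (\<forall>i \<in># K. i < n)"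
proof
  assume "K < {#n#}"
  then obtain i where i: "count K i < count {#n#} i" "\<forall>j>i. count K j = count {#n#} j"
    using less_mset_nat_iff by blast
  then have "i = n" by (simp split: if_splits)
  with i have "\<forall>j\<ge>n. count K j = 0" by (auto simp: le_less)
  then show "\<forall>i \<in># K. i < n" by (metis count_eq_zero_iff leI)
next
  assume "\<forall>i \<in># K. i < n"
  then have "\<forall>j\<ge>n. count K j = 0" by (metis count_eq_zero_iff leD)
  then show "K < {#n#}" by (intro less_mset_natI[of _ n]) auto
qed

text \<open>
  Ordinal addition on Cantor normal forms: a summand of the left operand survives only if no
  exponent on the right exceeds its own.
\<close>

definition mset_plus :: "nat multiset \<Rightarrow> nat multiset \<Rightarrow> nat multiset" (infixl \<open>\<boxplus>\<close> 65) where
  "M \<boxplus> N = filter_mset (\<lambda>i. \<forall>j \<in># N. j \<le> i) M + N"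

text \<open>
  The exponents \<open>i\<close> erased by adding \<open>M\<close> on the right. Laws of \<open>\<boxplus>\<close> then reduce, coefficient by
  coefficient, to propositional reasoning about domination.
\<close>

definition dominates :: "nat multiset \<Rightarrow> nat \<Rightarrow> bool" where
  "dominates M i \<longleftrightarrow> (\<exists>j \<in># M. i < j)"

lemma count_mset_plus:
  "count (M \<boxplus> N) i = (if dominates N i then 0 else count M i) + count N i"
  by (auto simp: mset_plus_def dominates_def not_le)

text \<open>
  Losing summands does not weaken domination: whatever erases a dominating exponent dominates as
  well.
\<close>

lemma dominates_mset_plus [simp]: "dominates (M \<boxplus> N) i \<longleftrightarrow> dominates M i \<or> dominates N i"
proof
  assume "dominates M i \<or> dominates N i"
  then show "dominates (M \<boxplus> N) i"
  proof (cases "dominates N i")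
    case False
    then obtain j where j: "j \<in># M" "i < j" using \<open>dominates M i \<or> dominates N i\<close>
      by (auto simp: dominates_def)
    moreover have "\<forall>k \<in># N. k \<le> i" using False by (auto simp: dominates_def not_less)
    ultimately show ?thesis unfolding dominates_def mset_plus_def
      by (intro bexI[of _ j]) auto
  qed (auto simp: mset_plus_def dominates_def)
qed (auto simp: mset_plus_def dominates_def)

lemma mset_plus_empty [simp]: "M \<boxplus> {#} = M" "{#} \<boxplus> M = M"
  by (auto simp: mset_plus_def)

lemma mset_plus_strict_mono: "N < N' \<Longrightarrow> M \<boxplus> N < M \<boxplus> N'"
proof -
  assume "N < N'"
  then obtain i where i: "count N i < count N' i" "\<And>j. i < j \<Longrightarrow> count N j = count N' j"
    using less_mset_nat_iff by blast
  then have "j \<in># N \<longleftrightarrow> j \<in># N'" if "i < j" for j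
    using that by (metis count_eq_zero_iff)
  then have dom: "dominates N j = dominates N' j" if "i \<le> j" for j
    using that unfolding dominates_def by (meson le_less_trans)
  show ?thesis
    by (rule less_mset_natI[of _ i]) (use i dom in \<open>auto simp: count_mset_plus\<close>)
qed

lemma mset_plus_upper: "M \<le> M \<boxplus> N"
proof (cases "N = {#}")
  case False
  then have "{#} < N" by simp
  from mset_plus_strict_mono[OF this, of M] show ?thesis by simp
qed simp

text \<open>
  Ordinal subtraction. If \<open>M < K\<close>, then \<open>N\<close> consists of the excess at the largest exponent where
  they differ together with everything of \<open>K\<close> below that exponent.
\<close>

lemma mset_plus_complement:
  assumes "M \<le> K"
  obtains N where "K = M \<boxplus> N"
proof (cases "M = K")
  case True
  then show thesis using that[of "{#}"] by simp
next
  case False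
  with assms obtain i where i: "count M i < count K i" "\<forall>j>i. count M j = count K j"
    using less_mset_nat_iff[of M K] by auto
  \<comment> \<open>the excess copies of the exponent where the two differ erase exactly what \<open>M\<close> has below it\<close>
  define N where "N = filter_mset (\<lambda>j. j < i) K + replicate_mset (count K i - count M i) i"
  have "dominates N j \<longleftrightarrow> j < i" for j
    using i by (auto simp: N_def dominates_def)
  then have "K = M \<boxplus> N"
    using i by (auto simp: multiset_eq_iff count_mset_plus N_def not_less le_less)
  then show thesis by (rule that)
qed

section \<open>Ordinals below \<open>\<omega>\<^sup>\<omega>\<close>\<close>

text \<open>
  The ordinal with Cantor normal form \<open>M\<close>, obtained as the order type of all smaller normal forms.
\<close>

definition ord_of :: "nat multiset \<Rightarrow> countable_ord" where
  "ord_of M = set_type {K. K < M}"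

lemma countable_mset [simp]: "countable (A :: nat multiset set)"
proof -
  have "countable (range (mset :: nat list \<Rightarrow> nat multiset))" by simp
  moreover have "range (mset :: nat list \<Rightarrow> nat multiset) = UNIV" by (simp add: surj_mset)
  ultimately show ?thesis by (metis countable_subset subset_UNIV)
qed

lemma less_ord_of_iff: "x < ord_of N \<longleftrightarrow> (\<exists>M<N. x = ord_of M)"
proof -
  have "{b \<in> {K. K < N}. b < M} = {K. K < M}" if "M < N" for M
    using that by auto
  then show ?thesis unfolding ord_of_def by (auto simp: less_set_type_iff)
qed

lemma ord_of_strict_mono: "strict_mono ord_of"
  by (rule strict_monoI) (use less_ord_of_iff in blast)

text \<open>
  The multisets below \<open>M \<boxplus> N\<close> are those below \<open>M\<close>, followed by the translates \<open>M \<boxplus> K\<close> with \<open>K < N\<close>.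
\<close>

lemma ord_of_plus: "ord_of M + ord_of N = ord_of (M \<boxplus> N)"
  unfolding ord_of_def
proof (rule set_type_plus[of _ _ _ id "(\<boxplus>) M"])
  show "{K. K < M \<boxplus> N} = id ` {K. K < M} \<union> (\<boxplus>) M ` {K. K < N}"
  proof (intro set_eqI iffI)
    fix K assume K: "K \<in> {K. K < M \<boxplus> N}"
    show "K \<in> id ` {K. K < M} \<union> (\<boxplus>) M ` {K. K < N}"
    proof (cases "K < M")
      case False
      then obtain L where L: "K = M \<boxplus> L" using mset_plus_complement by (meson not_less)
      then have "L < N"
        using K mset_plus_strict_mono[of N L M] by (metis less_asym linorder_neqE mem_Collect_eq)
      then show ?thesis using L by blast
    qed simp
  next
    fix K assume "K \<in> id ` {K. K < M} \<union> (\<boxplus>) M ` {K. K < N}"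
    then show "K \<in> {K. K < M \<boxplus> N}"
      using mset_plus_upper[of M N] mset_plus_strict_mono[of _ N M] by auto
  qed
  show "id a < M \<boxplus> b" if "a \<in> {K. K < M}" for a b
    using that mset_plus_upper[of M b] by auto
qed (auto simp: strict_mono_on_def intro: mset_plus_strict_mono)

lemma count_raise [simp]:
  "count (image_mset Suc M) (Suc i) = count M i" "count (image_mset Suc M) 0 = 0"
  by (induction M) auto

lemma mset_of_zeros:
  assumes "K < {#1::nat#}"
  shows "K = replicate_mset (count K 0) 0"
  using assms by (auto simp: less_mset_single_iff multiset_eq_iff count_eq_zero_iff)

lemma replicate_zero_strict_mono: "strict_mono (\<lambda>n. replicate_mset n (0::nat))"
  by (rule strict_monoI) (auto intro!: less_mset_natI[of _ 0])

lemma omega_eq: "\<omega> = ord_of {#1#}"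
  unfolding omega_def ord_of_def
proof (rule order_type_eq_set_type[of "\<lambda>n. replicate_mset n 0"])
  have "inj (\<lambda>n. replicate_mset n (0::nat))"
    using replicate_zero_strict_mono strict_mono_imp_inj_on by blast
  moreover have "range (\<lambda>n. replicate_mset n 0) = {K. K < {#1::nat#}}"
    using mset_of_zeros by (auto simp: less_mset_single_iff split: if_splits)
  ultimately show "bij_betw (\<lambda>n. replicate_mset n 0) (Field natLeq) {K. K < {#1::nat#}}"
    by (simp add: bij_betw_def Field_natLeq)
qed (auto simp: natLeq_def strict_mono_less_eq[OF replicate_zero_strict_mono])

text \<open>
  Every multiset is uniquely a finite number of zeros plus a raised multiset, and the latter is the
  more significant part. The multisets below the raised \<open>M\<close> thus form \<open>M\<close> many copies of \<open>\<omega>\<close>.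
\<close>

lemma omega_times_ord_of: "\<omega> * ord_of M = ord_of (image_mset Suc M)"
  unfolding omega_eq
  unfolding ord_of_def
proof (rule set_type_times[of _ _ _ "\<lambda>a b. a + image_mset Suc b"])
  show "{K. K < image_mset Suc M} =
      (\<lambda>(a, b). a + image_mset Suc b) ` ({K. K < {#1#}} \<times> {K. K < M})"
  proof (intro set_eqI iffI)
    fix K assume K: "K \<in> {K. K < image_mset Suc M}"
    define L where "L = image_mset (\<lambda>i. i - 1) (filter_mset (\<lambda>i. i \<noteq> 0) K)"
    have "image_mset Suc L = image_mset (\<lambda>i. i) (filter_mset (\<lambda>i. i \<noteq> 0) K)"
      unfolding L_def multiset.map_comp by (rule image_mset_cong) auto
    then have eq: "K = filter_mset (\<lambda>i. i = 0) K + image_mset Suc L"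
      using multiset_partition[of K "\<lambda>i. i = 0"] by simp
    then have c: "count L i = count K (Suc i)" for i
      by (metis (mono_tags, lifting) count_filter_mset count_raise(1) count_union nat.distinct(1) add_0)
    from K obtain i where i: "count K i < count (image_mset Suc M) i"
        "\<forall>j>i. count K j = count (image_mset Suc M) j"
      using less_mset_nat_iff by blast
    then obtain i' where "i = Suc i'" by (cases i) auto
    then have "L < M"
      using i c by (intro less_mset_natI[of _ i']) (simp, metis Suc_less_eq count_raise(1))
    moreover have "filter_mset (\<lambda>i. i = 0) K < {#1#}" by (auto simp: less_mset_single_iff)
    ultimately show "K \<in> (\<lambda>(a, b). a + image_mset Suc b) ` ({K. K < {#1#}} \<times> {K. K < M})"
      using eq by (metis (mono_tags, lifting) case_prod_conv image_eqI mem_Collect_eq mem_Sigma_iff)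
  next
    fix K assume "K \<in> (\<lambda>(a, b). a + image_mset Suc b) ` ({K. K < {#1#}} \<times> {K. K < M})"
    then obtain a b where K: "K = a + image_mset Suc b" and a: "a < {#1#}" and b: "b < M" by auto
    obtain i where i: "count b i < count M i" "\<forall>j>i. count b j = count M j"
      using b less_mset_nat_iff by blast
    have a0: "count a j = 0" if "j > 0" for j
      using a that by (auto simp: less_mset_single_iff count_eq_zero_iff)
    have "K < image_mset Suc M"
      unfolding K
    proof (rule less_mset_natI[of _ "Suc i"])
      show "count (a + image_mset Suc b) j = count (image_mset Suc M) j" if "Suc i < j" for j
        using that i a0 by (cases j) auto
    qed (use i a0 in simp)
    then show "K \<in> {K. K < image_mset Suc M}" by simp
  qed
next
  fix a b a' b' :: "nat multiset"
  assume a: "a \<in> {K. K < {#1#}}" "a' \<in> {K. K < {#1#}}" and less: "b < b' \<or> b = b' \<and> a < a'"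
  show "a + image_mset Suc b < a' + image_mset Suc b'"
  proof (cases "b = b'")
    case True
    then show ?thesis using less by simp
  next
    case False
    then have "b < b'" using less by simp
    then obtain i where i: "count b i < count b' i" "\<forall>j>i. count b j = count b' j"
      using less_mset_nat_iff by blast
    have a0: "count a j = 0" "count a' j = 0" if "j > 0" for j
      using a that by (auto simp: less_mset_single_iff count_eq_zero_iff)
    show ?thesis
    proof (rule less_mset_natI[of _ "Suc i"])
      show "count (a + image_mset Suc b) j = count (a' + image_mset Suc b') j" if "Suc i < j" for j
        using that i a0 by (cases j) auto
    qed (use i a0 in simp)
  qed
qed auto

text \<open>
  Below \<open>\<omega>\<^sup>n\<^sup>+\<^sup>1\<close>, the coefficient of the exponent \<open>n\<close> is the significant component, and what
  remains ranges over the ordinals below \<open>\<omega>\<^sup>n\<close>.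
\<close>

lemma single_times_omega: "ord_of {#n#} * \<omega> = ord_of {#Suc n#}"
  unfolding omega_eq
  unfolding ord_of_def
proof (rule set_type_times[of _ _ _ "\<lambda>a b. a + replicate_mset (count b 0) n"])
  show "{K. K < {#Suc n#}} =
      (\<lambda>(a, b). a + replicate_mset (count b 0) n) ` ({K. K < {#n#}} \<times> {K. K < {#1::nat#}})"
  proof (intro set_eqI iffI)
    fix K assume K: "K \<in> {K. K < {#Suc n#}}"
    define a where "a = filter_mset (\<lambda>i. i < n) K"
    define b where "b = replicate_mset (count K n) (0::nat)"
    have "K = a + replicate_mset (count b 0) n"
      using K by (auto simp: multiset_eq_iff less_mset_single_iff not_in_iff less_Suc_eq a_def b_def)
    moreover have "a < {#n#}" "b < {#1#}"
      by (auto simp: less_mset_single_iff a_def b_def split: if_splits)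
    ultimately have "K = (\<lambda>(a, b). a + replicate_mset (count b 0) n) (a, b)"
      and "(a, b) \<in> {K. K < {#n#}} \<times> {K. K < {#1::nat#}}" by simp_all
    then show "K \<in> (\<lambda>(a, b). a + replicate_mset (count b 0) n) ` ({K. K < {#n#}} \<times> {K. K < {#1::nat#}})"
      by (rule image_eqI)
  qed (auto simp: less_mset_single_iff less_Suc_eq split: if_splits)
next
  fix a b a' b' :: "nat multiset"
  assume a: "a \<in> {K. K < {#n#}}" "a' \<in> {K. K < {#n#}}"
    and b: "b \<in> {K. K < {#1::nat#}}" "b' \<in> {K. K < {#1::nat#}}" and less: "b < b' \<or> b = b' \<and> a < a'"
  show "a + replicate_mset (count b 0) n < a' + replicate_mset (count b' 0) n"
  proof (cases "b = b'")
    case True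
    then show ?thesis using less by simp
  next
    case False
    then have "count b 0 < count b' 0"
      using less b mset_of_zeros[of b] mset_of_zeros[of b']
        strict_mono_less[OF replicate_zero_strict_mono] by auto metis
    moreover have "count a j = 0" "count a' j = 0" if "j \<ge> n" for j
      using a that by (auto simp: less_mset_single_iff count_eq_zero_iff)
    ultimately show ?thesis by (intro less_mset_natI[of _ n]) auto
  qed
qed auto

lemma zero_eq: "0 = ord_of {#}"
  unfolding zero_countable_ord_def ord_of_def
  by (rule order_type_eq_set_type[of "\<lambda>_. {#}"]) (auto simp: bij_betw_def)

lemma one_eq: "1 = ord_of {#0#}"
  unfolding one_countable_ord_def ord_of_def
proof (rule order_type_eq_set_type[of "\<lambda>_. {#}"])
  have "{K. K < {#0::nat#}} = {{#}}" by (auto simp: less_mset_single_iff)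
  then show "bij_betw (\<lambda>_. {#}) (Field {(0::nat, 0)}) {K. K < {#0::nat#}}"
    by (simp add: bij_betw_def)
qed auto

lemmas ord_of_less_iff [simp] = strict_mono_less[OF ord_of_strict_mono]
lemmas ord_of_le_iff [simp] = strict_mono_less_eq[OF ord_of_strict_mono]
lemmas ord_of_eq_iff [simp] = strict_mono_eq[OF ord_of_strict_mono]

lemma single_mono: "m < n \<Longrightarrow> {#m#} < {#n::nat#}"
  by (simp add: less_mset_single_iff)

text \<open>
  The multiset of \<open>n\<close> zeros is the finite ordinal \<open>n\<close>. The bounds that define its power increase
  with the smaller exponent, so the bound from the predecessor of \<open>n\<close> is the supremum.
\<close>

lemma omega_power_finite: "omega_power (ord_of (replicate_mset n 0)) = ord_of {#n#}"
proof (induction n rule: less_induct)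
  case (less n)
  have below: "\<gamma> < ord_of (replicate_mset n 0) \<longleftrightarrow> (\<exists>m<n. \<gamma> = ord_of (replicate_mset m 0))" for \<gamma>
  proof
    assume "\<gamma> < ord_of (replicate_mset n 0)"
    then obtain M where M: "M < replicate_mset n 0" "\<gamma> = ord_of M" using less_ord_of_iff by blast
    moreover have "replicate_mset n (0::nat) < {#1#}"
      by (auto simp: less_mset_single_iff split: if_splits)
    ultimately have "M = replicate_mset (count M 0) 0"
      by (intro mset_of_zeros) (rule less_trans)
    then show "\<exists>m<n. \<gamma> = ord_of (replicate_mset m 0)"
      using M strict_mono_less[OF replicate_zero_strict_mono] by metis
  qed (auto simp: strict_mono_less[OF replicate_zero_strict_mono])
  have "(LEAST \<delta>. 1 \<le> \<delta> \<and> (\<forall>\<gamma><ord_of (replicate_mset n 0). omega_power \<gamma> * \<omega> \<le> \<delta>)) = ord_of {#n#}"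
  proof (rule Least_equality, intro conjI allI impI)
    show "1 \<le> ord_of {#n#}"
      unfolding one_eq ord_of_le_iff by (cases "n = 0") (auto intro: less_imp_le single_mono)
    show "omega_power \<gamma> * \<omega> \<le> ord_of {#n#}" if "\<gamma> < ord_of (replicate_mset n 0)" for \<gamma>
    proof -
      from that below obtain m where m: "m < n" "\<gamma> = ord_of (replicate_mset m 0)" by blast
      then have "omega_power \<gamma> * \<omega> = ord_of {#Suc m#}" using less single_times_omega by simp
      moreover have "{#Suc m#} \<le> {#n#}"
        using m by (cases "Suc m = n") (auto intro: less_imp_le single_mono)
      ultimately show ?thesis by simp
    qed
  next
    fix \<delta> assume \<delta>: "1 \<le> \<delta> \<and> (\<forall>\<gamma><ord_of (replicate_mset n 0). omega_power \<gamma> * \<omega> \<le> \<delta>)"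
    show "ord_of {#n#} \<le> \<delta>"
    proof (cases n)
      case 0
      then show ?thesis using \<delta> one_eq by simp
    next
      case (Suc m)
      then have "omega_power (ord_of (replicate_mset m 0)) * \<omega> \<le> \<delta>" using \<delta> below by blast
      then show ?thesis using less[of m] Suc single_times_omega by simp
    qed
  qed
  then show ?case by (subst omega_power.simps)
qed

text \<open>
  The least upper bound in the definition of \<open>\<omega>\<^sup>\<omega>\<close> is meaningful only once some upper bound is
  known; the order type of all multisets is one.
\<close>

lemma universe_eq: "universe = range ord_of"
proof -
  have fin: "\<gamma> < \<omega> \<longleftrightarrow> (\<exists>n. \<gamma> = ord_of (replicate_mset n 0))" for \<gamma>
  proof
    assume "\<gamma> < \<omega>"
    then obtain K where "K < {#1#}" "\<gamma> = ord_of K" unfolding omega_eq less_ord_of_iff by blast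
    then show "\<exists>n. \<gamma> = ord_of (replicate_mset n 0)" using mset_of_zeros[of K] by metis
  qed (auto simp: omega_eq less_mset_single_iff split: if_splits)
  define P where "P \<delta> \<longleftrightarrow> 1 \<le> \<delta> \<and> (\<forall>n. ord_of {#Suc n#} \<le> \<delta>)" for \<delta>
  have "(\<forall>\<gamma><\<omega>. omega_power \<gamma> * \<omega> \<le> \<delta>) \<longleftrightarrow> (\<forall>n. ord_of {#Suc n#} \<le> \<delta>)" for \<delta>
    unfolding fin by (metis omega_power_finite single_times_omega)
  then have Least: "omega_power \<omega> = (LEAST \<delta>. P \<delta>)"
    unfolding P_def by (subst omega_power.simps) simp
  have "ord_of M < set_type (UNIV :: nat multiset set)" for M
    unfolding ord_of_def by (auto simp: less_set_type_iff)
  then have "P (set_type (UNIV :: nat multiset set))"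
    unfolding P_def one_eq using less_imp_le by blast
  then have P: "P (omega_power \<omega>)" unfolding Least by (rule LeastI)
  show ?thesis
  proof (intro set_eqI iffI)
    fix x assume "x \<in> universe"
    then have "x < (LEAST \<delta>. P \<delta>)" by (simp add: universe_def Least)
    then have "\<not> P x" by (rule not_less_Least)
    then obtain M where "x < ord_of M" unfolding P_def one_eq by (meson not_le)
    then show "x \<in> range ord_of" using less_ord_of_iff by blast
  next
    fix x assume "x \<in> range ord_of"
    then obtain M where M: "x = ord_of M" by blast
    have "M < {#Suc (Max (set_mset M))#}"
      by (auto simp: less_mset_single_iff less_Suc_eq_le)
    then have "x < ord_of {#Suc (Max (set_mset M))#}" using M by simp
    also have "\<dots> \<le> omega_power \<omega>" using P unfolding P_def by blast
    finally show "x \<in> universe" by (simp add: universe_def)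
  qed
qed

section \<open>Soundness\<close>

primrec mset_eval :: "(nat \<Rightarrow> nat multiset) \<Rightarrow> trm \<Rightarrow> nat multiset" where
  "mset_eval v (Var i) = v i"
| "mset_eval v Zero = {#}"
| "mset_eval v (E \<oplus> F) = mset_eval v E \<boxplus> mset_eval v F"
| "mset_eval v (Omega_Times E) = image_mset Suc (mset_eval v E)"

lemma eval_trm_ord_of: "eval_trm (ord_of \<circ> v) E = ord_of (mset_eval v E)"
  by (induction E) (simp_all add: zero_eq ord_of_plus omega_times_ord_of)

text \<open>
  From here on ordinals are no longer needed: the structure is isomorphic to the finite multisets
  of natural numbers with \<open>{#}\<close>, \<open>\<boxplus>\<close> and raising by one.
\<close>

lemma equivalent_iff_mset_eval: "equivalent E F \<longleftrightarrow> (\<forall>v. mset_eval v E = mset_eval v F)"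
proof -
  have "range v \<subseteq> universe \<longleftrightarrow> (\<exists>w. v = ord_of \<circ> w)" for v :: "nat \<Rightarrow> countable_ord"
  proof
    assume "range v \<subseteq> universe"
    then have "\<forall>i. \<exists>M. v i = ord_of M" unfolding universe_eq by blast
    then obtain w where "\<forall>i. v i = ord_of (w i)" by metis
    then show "\<exists>w. v = ord_of \<circ> w" by (intro exI[of _ w]) auto
  qed (auto simp: universe_eq)
  then show ?thesis unfolding equivalent_def by (auto simp: eval_trm_ord_of)
qed

lemma dominates_empty [simp]: "\<not> dominates {#} i"
  by (simp add: dominates_def)

lemma dominates_raiseI: "i \<in># M \<Longrightarrow> dominates (image_mset Suc M) i"
  by (auto simp: dominates_def)

lemma dominates_raise_Suc [simp]: "dominates (image_mset Suc M) (Suc i) \<longleftrightarrow> dominates M i"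
  by (auto simp: dominates_def)

lemma mset_plus_assoc: "L \<boxplus> (M \<boxplus> N) = (L \<boxplus> M) \<boxplus> N"
  by (rule multiset_eqI) (auto simp: count_mset_plus)

lemma raise_mset_plus: "image_mset Suc (M \<boxplus> N) = image_mset Suc M \<boxplus> image_mset Suc N"
proof (rule multiset_eqI)
  show "count (image_mset Suc (M \<boxplus> N)) i = count (image_mset Suc M \<boxplus> image_mset Suc N) i" for i
    by (cases i) (auto simp: count_mset_plus)
qed

text \<open>
  Every exponent of \<open>x\<close> is exceeded by its successor in the raised copy of \<open>x\<close>.
\<close>

lemma mset_plus_absorb: "x \<boxplus> y \<boxplus> image_mset Suc x = y \<boxplus> image_mset Suc x"
  by (rule multiset_eqI) (auto simp: count_mset_plus count_eq_zero_iff dest: dominates_raiseI)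

text \<open>
  At any exponent where the first two summands survive the later occurrences of \<open>x\<close> and \<open>y\<close>,
  neither \<open>x\<close> nor \<open>y\<close> dominates that exponent, so their coefficients just add up in either order.
\<close>

lemma mset_plus_swap: "x \<boxplus> y \<boxplus> z \<boxplus> x \<boxplus> t \<boxplus> y = y \<boxplus> x \<boxplus> z \<boxplus> x \<boxplus> t \<boxplus> y"
  by (rule multiset_eqI) (auto simp: count_mset_plus)

lemma satisfied_Sigma: "e \<in> Sigma_identities \<Longrightarrow> satisfied e"
  unfolding Sigma_identities_def satisfied_def equivalent_iff_mset_eval
  by (auto simp: Let_def mset_plus_assoc raise_mset_plus mset_plus_absorb intro: mset_plus_swap)

lemma mset_eval_subst: "mset_eval v (subst_trm \<sigma> E) = mset_eval (\<lambda>i. mset_eval v (\<sigma> i)) E"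
  by (induction E) auto

lemma derivable_sound: "derivable A (E, F) \<Longrightarrow> (\<And>e. e \<in> A \<Longrightarrow> satisfied e) \<Longrightarrow> equivalent E F"
proof (induction "(E, F)" arbitrary: E F rule: derivable.induct)
  case axiom
  then show ?case by (fastforce simp: satisfied_def)
qed (auto simp: equivalent_iff_mset_eval mset_eval_subst)

section \<open>Terms modulo derivability\<close>

text \<open>
  Terms modulo derivability. In this quotient, derivations become equational reasoning in a monoid.
\<close>

quotient_type free_algebra = trm / "\<lambda>E F. derivable Sigma_identities (E, F)"
  by (intro equivpI reflpI sympI transpI) (auto intro: derivable.intros)

instantiation free_algebra :: "{zero, plus}"
begin

lift_definition zero_free_algebra :: free_algebra is Zero .

lift_definition plus_free_algebra :: "free_algebra \<Rightarrow> free_algebra \<Rightarrow> free_algebra" is Plus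
  by (rule derivable.cong_Plus)

instance ..

end

lift_definition omega_times :: "free_algebra \<Rightarrow> free_algebra" is Omega_Times
  by (rule derivable.cong_Omega_Times)

lift_definition generator :: "nat \<Rightarrow> free_algebra" is Var .

lemma Sigma_members:
  "(Var 0 \<oplus> (Var 1 \<oplus> Var 2), Var 0 \<oplus> Var 1 \<oplus> Var 2) \<in> Sigma_identities"
  "(Omega_Times (Var 0 \<oplus> Var 1), Omega_Times (Var 0) \<oplus> Omega_Times (Var 1)) \<in> Sigma_identities"
  "(Var 0 \<oplus> Var 1 \<oplus> Omega_Times (Var 0), Var 1 \<oplus> Omega_Times (Var 0)) \<in> Sigma_identities"
  "(Var 0 \<oplus> Var 1 \<oplus> Var 2 \<oplus> Var 0 \<oplus> Var 3 \<oplus> Var 1,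
    Var 1 \<oplus> Var 0 \<oplus> Var 2 \<oplus> Var 0 \<oplus> Var 3 \<oplus> Var 1) \<in> Sigma_identities"
  "(Var 0 \<oplus> Zero, Var 0) \<in> Sigma_identities"
  "(Zero \<oplus> Var 0, Var 0) \<in> Sigma_identities"
  "(Omega_Times Zero, Zero) \<in> Sigma_identities"
  by (simp_all add: Sigma_identities_def Let_def)

lemma Sigma_instance:
  assumes "(E, F) \<in> Sigma_identities"
  shows "derivable Sigma_identities (subst_trm ((!) ts) E, subst_trm ((!) ts) F)"
  by (intro derivable.subst derivable.axiom assms)

instance free_algebra :: monoid_add
proof
  fix x y z :: free_algebra
  show "x + y + z = x + (y + z)"
  proof transfer
    fix E F G
    show "derivable Sigma_identities (E \<oplus> F \<oplus> G, E \<oplus> (F \<oplus> G))"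
      using Sigma_instance[OF Sigma_members(1), of "[E, F, G]"]
      by (auto intro: derivable.sym)
  qed
  show "0 + x = x"
  proof transfer
    fix E
    show "derivable Sigma_identities (Zero \<oplus> E, E)"
      using Sigma_instance[OF Sigma_members(6), of "[E]"] by simp
  qed
  show "x + 0 = x"
  proof transfer
    fix E
    show "derivable Sigma_identities (E \<oplus> Zero, E)"
      using Sigma_instance[OF Sigma_members(5), of "[E]"] by simp
  qed
qed

lemma omega_times_zero [simp]: "omega_times 0 = 0"
  by transfer (rule derivable.axiom, rule Sigma_members)

lemma omega_times_add: "omega_times (x + y) = omega_times x + omega_times y"
proof transfer
  fix E F
  show "derivable Sigma_identities (Omega_Times (E \<oplus> F), Omega_Times E \<oplus> Omega_Times F)"
    using Sigma_instance[OF Sigma_members(2), of "[E, F]"] by simp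
qed

lemma absorb: "x + (y + omega_times x) = y + omega_times x"
  unfolding add.assoc[symmetric]
proof transfer
  fix E F
  show "derivable Sigma_identities (E \<oplus> F \<oplus> Omega_Times E, F \<oplus> Omega_Times E)"
    using Sigma_instance[OF Sigma_members(3), of "[E, F]"] by simp
qed

lemma swap: "x + (y + (z + (x + (t + y)))) = y + (x + (z + (x + (t + y))))"
  for x y z t :: free_algebra
proof -
  have "x + y + z + x + t + y = y + x + z + x + t + y"
  proof transfer
    fix x y z t
    show "derivable Sigma_identities (x \<oplus> y \<oplus> z \<oplus> x \<oplus> t \<oplus> y, y \<oplus> x \<oplus> z \<oplus> x \<oplus> t \<oplus> y)"
      using Sigma_instance[OF Sigma_members(4), of "[x, y, z, t]"] by (simp add: numeral_eq_Suc)
  qed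
  then show ?thesis by (simp add: add.assoc)
qed

text \<open>
  By induction on the exponent: first insert an intermediate power, which absorbs the remaining
  \<open>x\<close>, and then absorb that power in turn.
\<close>

lemma absorb_power: "x + (y + (omega_times ^^ Suc n) x) = y + (omega_times ^^ Suc n) x"
proof (induction n arbitrary: y)
  case 0
  show ?case by (simp add: absorb)
next
  case (Suc n)
  let ?t = "(omega_times ^^ Suc n) x"
  have xt: "x + ?t = ?t" using Suc.IH[of 0] by simp
  have "x + (y + omega_times ?t) = x + (?t + (y + omega_times ?t))" by (simp only: absorb)
  also have "\<dots> = (x + ?t) + (y + omega_times ?t)" by (simp only: add.assoc)
  also have "\<dots> = y + omega_times ?t" by (simp only: xt absorb)
  finally show ?case by simp
qed

section \<open>Words\<close>

text \<open>
  The pair \<open>(i, k)\<close> stands for \<open>\<omega>\<^sup>k x\<^sub>i\<close>. By distributivity every term is a sum of letters.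
\<close>

type_synonym letter = "nat \<times> nat"

definition letter_value :: "letter \<Rightarrow> free_algebra" where
  "letter_value a = (omega_times ^^ snd a) (generator (fst a))"

definition word_value :: "letter list \<Rightarrow> free_algebra" where
  "word_value w = sum_list (map letter_value w)"

lemma word_value_simps [simp]:
  "word_value [] = 0"
  "word_value (a # w) = letter_value a + word_value w"
  "word_value (u @ w) = word_value u + word_value w"
  by (simp_all add: word_value_def)

primrec word_of :: "trm \<Rightarrow> letter list" where
  "word_of (Var i) = [(i, 0)]"
| "word_of Zero = []"
| "word_of (E \<oplus> F) = word_of E @ word_of F"
| "word_of (Omega_Times E) = map (apsnd Suc) (word_of E)"

lemma word_value_raise: "word_value (map (apsnd Suc) w) = omega_times (word_value w)"
  by (induction w) (simp_all add: omega_times_add letter_value_def)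

lemma word_value_word_of: "word_value (word_of E) = abs_free_algebra E"
  by (induction E)
    (simp_all add: word_value_raise letter_value_def flip: generator.abs_eq
      zero_free_algebra.abs_eq plus_free_algebra.abs_eq omega_times.abs_eq)

lemma absorb_letter:
  assumes "(i, m) \<in> set w" "k < m"
  shows "word_value ((i, k) # w) = word_value w"
proof -
  obtain u u' where w: "w = u @ (i, m) # u'" using assms(1) by (meson split_list)
  obtain n where n: "m = Suc n + k" using assms(2) less_iff_Suc_add[of k m] by (auto simp: add.commute)
  have "letter_value (i, m) = (omega_times ^^ Suc n) (letter_value (i, k))"
    by (simp add: letter_value_def n funpow_add)
  then have "letter_value (i, k) + (word_value u + letter_value (i, m)) =
      word_value u + letter_value (i, m)"
    by (simp only: absorb_power)
  then show ?thesis by (simp add: w flip: add.assoc)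
qed

text \<open>
  Which of the two letters recurs first does not matter, since the identity may be read with the
  roles of its two variables exchanged.
\<close>

lemma swap_letters:
  assumes "a \<in> set w" "b \<in> set w"
  shows "word_value (a # b # w) = word_value (b # a # w)"
proof (cases "a = b")
  case False
  have *: "word_value (c # d # u @ d # u' @ c # u'') = word_value (d # c # u @ d # u' @ c # u'')"
    for c d u u' u''
  proof -
    let ?c = "letter_value c" and ?d = "letter_value d"
    have "?c + (?d + (word_value u + (?d + (word_value u' + ?c)))) + word_value u'' =
        ?d + (?c + (word_value u + (?d + (word_value u' + ?c)))) + word_value u''"
      by (simp only: swap[of ?d ?c])
    then show ?thesis by (simp add: add.assoc)
  qed
  obtain u v where w: "w = u @ a # v" using assms(1) by (meson split_list)
  with assms(2) False consider "b \<in> set v" | "b \<in> set u" by auto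
  then show ?thesis
  proof cases
    case 1
    then obtain v1 v2 where "v = v1 @ b # v2" by (meson split_list)
    then show ?thesis using *[of b a u v1 v2] w by simp
  next
    case 2
    then obtain u1 u2 where "u = u1 @ b # u2" by (meson split_list)
    then show ?thesis using *[of a b u1 u2 v] w by simp
  qed
qed simp

lemma move_letter_to_front:
  assumes "a \<in> set q" "set p \<subseteq> set q"
  shows "word_value (p @ a # q) = word_value (a # p @ q)"
  using assms(2)
proof (induction p)
  case (Cons b p)
  have "word_value ((b # p) @ a # q) = word_value (b # a # p @ q)"
    using Cons by simp
  also have "\<dots> = word_value (a # b # p @ q)"
    using Cons.prems assms(1) by (intro swap_letters) auto
  finally show ?case by simp
qed simp

section \<open>Words up to swaps\<close>

text \<open>
  If \<open>P\<close> holds for the letters of degree larger than those in \<open>Q\<close>, then the letters counted are the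
  summands that survive in an ordinal sum. If \<open>P\<close> and \<open>Q\<close> single out two different letters, then
  the counts characterize a word up to swaps.
\<close>

primrec tail_count :: "('a \<Rightarrow> bool) \<Rightarrow> ('a \<Rightarrow> bool) \<Rightarrow> 'a list \<Rightarrow> nat" where
  "tail_count P Q [] = 0"
| "tail_count P Q (a # w) = (if Q a \<and> \<not> (\<exists>b \<in> set w. P b) then 1 else 0) + tail_count P Q w"

lemma tail_count_append:
  assumes "(\<exists>b \<in> set w. P b) \<or> (\<forall>c \<in> set u. \<not> Q c)"
  shows "tail_count P Q (u @ w) = tail_count P Q w"
  using assms by (induction u) auto

lemma tail_count_le: "tail_count P ((=) c) w \<le> count (mset w) c"
  by (induction w) auto

lemma tail_count_total:
  "\<forall>b \<in> set w. \<not> P b \<Longrightarrow> tail_count P ((=) c) w = count (mset w) c"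
  by (induction w) auto

text \<open>
  A word is determined, up to swaps of adjacent recurring letters, by how often each letter \<open>c\<close>
  occurs, in total and after the last occurrence of each other letter \<open>b\<close>. To transform \<open>w\<close> into a word starting
  with the first letter \<open>a\<close> of \<open>u\<close>, move the first \<open>a\<close> of \<open>w\<close> to the front. The letters it has to
  pass all recur later, for otherwise fewer occurrences of \<open>a\<close> would follow the last \<open>b\<close> in \<open>u\<close>
  than in \<open>w\<close>; and if this \<open>a\<close> is the last one, the same counts show that it is already in front.
\<close>

lemma word_value_eqI:
  assumes "mset u = mset w"
    and "\<And>b c. b \<noteq> c \<Longrightarrow> tail_count ((=) b) ((=) c) u = tail_count ((=) b) ((=) c) w"
  shows "word_value u = word_value w"
  using assms
proof (induction u arbitrary: w)
  case (Cons a u)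
  from Cons.prems(1) have "a \<in> set w" by (metis list.set_intros(1) set_mset_mset)
  then obtain p q where w: "w = p @ a # q" and ap: "a \<notin> set p" by (meson split_list_first)
  from Cons.prems(1) have mset_u: "mset u = mset (p @ q)" unfolding w by simp
  then have set_u: "set u = set (p @ q)" by (metis set_mset_mset)
  have p_q: "set p \<subseteq> set q"
  proof (rule subsetI, rule ccontr)
    fix b assume b: "b \<in> set p" "b \<notin> set q"
    with ap have ab: "b \<noteq> a" by auto
    have "tail_count ((=) b) ((=) a) w = tail_count ((=) b) ((=) a) (a # q)"
      unfolding w using ap by (intro tail_count_append) auto
    also have "\<dots> = count (mset w) a"
      using b ab ap by (subst tail_count_total) (auto simp: w not_in_iff[symmetric])
    finally have "tail_count ((=) b) ((=) a) w = Suc (count (mset u) a)"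
      using Cons.prems(1) by (metis count_add_mset mset.simps(2))
    moreover have "tail_count ((=) b) ((=) a) (a # u) = tail_count ((=) b) ((=) a) u"
      using b set_u by auto
    ultimately show False
      using Cons.prems(2)[OF ab] tail_count_le[of "(=) b" a u] by simp
  qed
  have "word_value w = word_value (a # p @ q)"
  proof (cases "a \<in> set q")
    case True
    then show ?thesis using move_letter_to_front[OF _ p_q] w by simp
  next
    case False
    have "p = []"
    proof (rule ccontr)
      assume "p \<noteq> []"
      then obtain b where b: "b \<in> set p" by (cases p) auto
      with ap have ab: "a \<noteq> b" by auto
      have "tail_count ((=) a) ((=) b) w = tail_count ((=) a) ((=) b) (a # q)"
        unfolding w by (intro tail_count_append) auto
      also have "\<dots> \<le> count (mset (a # q)) b" by (rule tail_count_le)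
      also have "\<dots> < count (mset w) b" using b ab by (simp add: w)
      also have "\<dots> = count (mset u) b" using ab by (simp flip: Cons.prems(1))
      also have "\<dots> = tail_count ((=) a) ((=) b) u"
        using False ap set_u by (subst tail_count_total) auto
      also have "\<dots> = tail_count ((=) a) ((=) b) (a # u)" using ab by simp
      finally show False using Cons.prems(2)[OF ab] by simp
    qed
    then show ?thesis using w by simp
  qed
  moreover have "word_value u = word_value (p @ q)"
  proof (rule Cons.IH[OF mset_u])
    fix b c :: letter assume bc: "b \<noteq> c"
    \<comment> \<open>the invariants of \<open>u\<close> and \<open>w\<close> agree without \<open>a\<close>: their last \<open>b\<close>, if any, lies beyond it\<close>
    show "tail_count ((=) b) ((=) c) u = tail_count ((=) b) ((=) c) (p @ q)"
    proof (cases "b \<in> set q")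
      case True
      then have "tail_count ((=) b) ((=) c) (p @ q) = tail_count ((=) b) ((=) c) w"
        using tail_count_append[of q "(=) b" p "(=) c"]
          tail_count_append[of q "(=) b" "p @ [a]" "(=) c"] w by auto
      also have "\<dots> = tail_count ((=) b) ((=) c) u"
        using Cons.prems(2)[OF bc] True set_u by auto
      finally show ?thesis by simp
    next
      case False
      then have "b \<notin> set u" "b \<notin> set (p @ q)" using p_q set_u by auto
      then show ?thesis
        using tail_count_total[of u "(=) b" c] tail_count_total[of "p @ q" "(=) b" c] mset_u
        by (metis)
    qed
  qed
  ultimately show ?case by simp
qed simp

section \<open>Reduced words\<close>

text \<open>
  The words to which absorption cannot be applied.
\<close>

definition reduced :: "letter list \<Rightarrow> bool" where
  "reduced = sorted_wrt (\<lambda>a b. fst a = fst b \<longrightarrow> snd b \<le> snd a)"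

lemma reduced_simps [simp]:
  "reduced []"
  "reduced (a # w) \<longleftrightarrow> (\<forall>m. (fst a, m) \<in> set w \<longrightarrow> m \<le> snd a) \<and> reduced w"
  by (auto simp: reduced_def)

primrec reduce :: "letter list \<Rightarrow> letter list" where
  "reduce [] = []"
| "reduce (a # w) =
     (if \<exists>m>snd a. (fst a, m) \<in> set (reduce w) then reduce w else a # reduce w)"

lemma reduced_reduce: "reduced (reduce w)"
  by (induction w) (auto simp: not_less)

lemma word_value_reduce: "word_value (reduce w) = word_value w"
proof (induction w)
  case (Cons a w)
  then show ?case using absorb_letter[of "fst a" _ "reduce w" "snd a"] by auto
qed simp

section \<open>Separating reduced words\<close>

text \<open>
  By soundness, evaluation is well defined on derivability classes.
\<close>

lift_definition class_eval :: "(nat \<Rightarrow> nat multiset) \<Rightarrow> free_algebra \<Rightarrow> nat multiset" is mset_eval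
  using derivable_sound[OF _ satisfied_Sigma] by (simp add: equivalent_iff_mset_eval)

lemma class_eval_simps [simp]:
  "class_eval v (generator i) = v i"
  "class_eval v 0 = {#}"
  "class_eval v (x + y) = class_eval v x \<boxplus> class_eval v y"
  "class_eval v (omega_times x) = image_mset Suc (class_eval v x)"
  by (transfer, simp)+

lemma class_eval_letter:
  "class_eval (\<lambda>j. replicate_mset (A j) (d j)) (letter_value (i, k)) = replicate_mset (A i) (d i + k)"
  unfolding letter_value_def by (induction k) simp_all

text \<open>
  These valuations read off how often \<open>(x, k)\<close> occurs after the last \<open>(y, m)\<close>. The exponents are
  chosen such that the value of \<open>(x, k)\<close> has degree \<open>m + k\<close> and that of \<open>(y, m)\<close> has degree
  \<open>m + k + 1\<close>, so that \<open>(y, m)\<close> erases every \<open>(x, k)\<close> before it. The coefficients \<open>A\<close> and \<open>B\<close> serve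
  to tell the two variables apart, or to hide the second one.
\<close>

definition test_valuation :: "nat \<Rightarrow> nat \<Rightarrow> nat \<Rightarrow> nat \<Rightarrow> nat \<Rightarrow> nat \<Rightarrow> nat \<Rightarrow> nat multiset" where
  "test_valuation A B x k y m = (\<lambda>j. replicate_mset
     (if j = x then A else if j = y then B else 0) (if j = x then m else Suc k))"

lemma dominates_replicate: "dominates (replicate_mset n j) i \<longleftrightarrow> 0 < n \<and> i < j"
  by (auto simp: dominates_def split: if_splits)

lemma dominates_test_valuation:
  assumes "x \<noteq> y" "0 < A"
  shows "dominates (class_eval (test_valuation A B x k y m) (word_value w)) (m + k) \<longleftrightarrow>
    (\<exists>a \<in> set w. fst a = x \<and> k < snd a \<or> 0 < B \<and> fst a = y \<and> m \<le> snd a)"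
proof (induction w)
  case (Cons a w)
  then show ?case using assms
    by (cases a) (auto simp: test_valuation_def class_eval_letter dominates_replicate)
qed simp

text \<open>
  The letter \<open>(y, m - 1)\<close> has the same degree as \<open>(x, k)\<close> and is counted along with it, which
  accounts for the second summand.
\<close>

lemma count_test_valuation:
  fixes A B x k y m :: nat
  assumes "x \<noteq> y" "0 < A"
  defines "P \<equiv> (\<lambda>a. fst a = x \<and> k < snd a \<or> 0 < B \<and> fst a = y \<and> m \<le> snd a)"
  shows "count (class_eval (test_valuation A B x k y m) (word_value w)) (m + k) =
    A * tail_count P ((=) (x, k)) w + B * tail_count P (\<lambda>a. fst a = y \<and> Suc (snd a) = m) w"
proof (induction w)
  case (Cons a w)
  let ?v = "test_valuation A B x k y m"
  have letter: "count (class_eval ?v (letter_value a)) (m + k) =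
      (if (x, k) = a then A else 0) + (if fst a = y \<and> Suc (snd a) = m then B else 0)"
    using assms(1) by (cases a) (auto simp: test_valuation_def class_eval_letter)
  have dom: "dominates (class_eval ?v (word_value w)) (m + k) \<longleftrightarrow> (\<exists>b \<in> set w. P b)"
    unfolding P_def by (rule dominates_test_valuation[OF assms(1,2)])
  have "count (class_eval ?v (word_value (a # w))) (m + k) =
      (if \<exists>b \<in> set w. P b then 0 else count (class_eval ?v (letter_value a)) (m + k)) +
      count (class_eval ?v (word_value w)) (m + k)"
    by (simp only: word_value_simps class_eval_simps count_mset_plus dom)
  then show ?case
    unfolding Cons.IH letter by (cases "\<exists>b \<in> set w. P b") (simp_all add: distrib_left)
qed simp

text \<open>
  Taking the multiplicity of \<open>x\<close> to be \<open>1\<close> and \<open>2\<close> separates the contribution of \<open>(x, k)\<close> from that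
  of the other letter of the same degree.
\<close>

lemma tail_count_determined:
  fixes x k y m :: nat
  assumes "x \<noteq> y" and "\<And>v. class_eval v (word_value u) = class_eval v (word_value w)"
  defines "P \<equiv> (\<lambda>B a. fst a = x \<and> k < snd a \<or> 0 < B \<and> fst a = y \<and> m \<le> snd a)"
  shows "tail_count (P (B :: nat)) ((=) (x, k)) u = tail_count (P B) ((=) (x, k)) w"
  using count_test_valuation[OF assms(1), of 1 B k m u] count_test_valuation[OF assms(1), of 2 B k m u]
    count_test_valuation[OF assms(1), of 1 B k m w] count_test_valuation[OF assms(1), of 2 B k m w]
  by (simp add: assms(2) P_def)

lemma reduced_tail_count_total:
  "reduced w \<Longrightarrow> tail_count (\<lambda>a. fst a = x \<and> k < snd a) ((=) (x, k)) w = count (mset w) (x, k)"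
proof (induction w)
  case (Cons a w)
  then have "\<not> (\<exists>b \<in> set w. fst b = x \<and> k < snd b)" if "a = (x, k)"
    using that by (auto simp: not_less)
  with Cons show ?case by auto
qed simp

text \<open>
  In a reduced word the letters of one variable come in a known order, so their relative positions
  carry no information beyond their multiplicities.
\<close>

lemma reduced_tail_count_same_variable:
  assumes "reduced w" "k \<noteq> m"
  shows "tail_count ((=) (x, m)) ((=) (x, k)) w =
    (if m < k \<and> (x, m) \<in> set w then 0 else count (mset w) (x, k))"
  using assms(1)
proof (induction w)
  case (Cons a w)
  have "m \<le> k" if "a = (x, k)" "(x, m) \<in> set w" using Cons.prems that by simp
  moreover have "count (mset w) (x, k) = 0" if "a = (x, m)" "m < k"
    using Cons.prems that leD[of k m] by (auto simp: count_eq_zero_iff)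
  ultimately show ?case using Cons assms(2) by auto
qed simp

text \<open>
  In a reduced word, letters \<open>(x, k')\<close> with \<open>k' > k\<close> never follow \<open>(x, k)\<close>, and letters \<open>(y, m')\<close>
  with \<open>m' > m\<close> precede all occurrences of \<open>(y, m)\<close>. The second premise holds whenever \<open>(y, m)\<close>
  occurs in the word, and is formulated so that it passes to suffixes.
\<close>

lemma reduced_tail_count_other_variable:
  assumes "reduced w" and "\<forall>m'>m. (y, m') \<in> set w \<longrightarrow> (y, m) \<in> set w"
  shows "tail_count (\<lambda>a. fst a = x \<and> k < snd a \<or> fst a = y \<and> m \<le> snd a) ((=) (x, k)) w =
    tail_count ((=) (y, m)) ((=) (x, k)) w"
  using assms
proof (induction w)
  case (Cons a w)
  have y: "\<forall>m'>m. (y, m') \<in> set w \<longrightarrow> (y, m) \<in> set w"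
    using Cons.prems by (metis fst_conv leD list.set_intros(2) reduced_simps(2) set_ConsD snd_conv)
  have "(\<exists>b \<in> set w. fst b = x \<and> k < snd b \<or> fst b = y \<and> m \<le> snd b) \<longleftrightarrow> (y, m) \<in> set w"
    if "a = (x, k)"
  proof
    assume "\<exists>b \<in> set w. fst b = x \<and> k < snd b \<or> fst b = y \<and> m \<le> snd b"
    then obtain i j where "(i, j) \<in> set w" "i = x \<and> k < j \<or> i = y \<and> m \<le> j" by auto
    moreover have "\<not> k < j" if "(x, j) \<in> set w" for j
      using that \<open>a = (x, k)\<close> Cons.prems(1) by (simp add: not_less)
    ultimately show "(y, m) \<in> set w" using y le_neq_implies_less by blast
  qed force
  then show ?case using Cons.IH Cons.prems(1) y by auto
qed simp

text \<open>
  The evaluations determine all counts that characterize the word: multiplicities and relations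
  between different variables by test valuations, and those within one variable by the ordering of
  reduced words.
\<close>

lemma reduced_word_value_eqI:
  assumes "reduced u" "reduced w"
    and eval: "\<And>v. class_eval v (word_value u) = class_eval v (word_value w)"
  shows "word_value u = word_value w"
proof (rule word_value_eqI)
  \<comment> \<open>with \<open>B = 0\<close> only \<open>x\<close> has a nonzero value; the other variable just has to be different\<close>
  have "count (mset u) (x, k) = count (mset w) (x, k)" for x k
    using tail_count_determined[of x "Suc x", OF _ eval, where B = 0] assms(1,2)
    by (simp add: reduced_tail_count_total)
  then show mset: "mset u = mset w" by (auto simp: multiset_eq_iff)
  then have set: "set u = set w" by (metis set_mset_mset)
  fix b c :: letter assume bc: "b \<noteq> c"
  obtain x k y m where c: "c = (x, k)" and b: "b = (y, m)" by fastforce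
  show "tail_count ((=) b) ((=) c) u = tail_count ((=) b) ((=) c) w"
  proof (cases "x = y")
    case True
    then show ?thesis
      using reduced_tail_count_same_variable[of _ k m x] assms(1,2) bc mset set b c by simp
  next
    case False
    show ?thesis
    proof (cases "b \<in> set w")
      case True
      then show ?thesis
        using tail_count_determined[OF False eval, where k = k and m = m and B = 1] set b c
          reduced_tail_count_other_variable[OF assms(1), of m y x k]
          reduced_tail_count_other_variable[OF assms(2), of m y x k] by simp
    next
      case False
      then show ?thesis
        using tail_count_total[of u "(=) b" c] tail_count_total[of w "(=) b" c] mset set by metis
    qed
  qed
qed

section \<open>The axiomatization\<close>

lemma equivalent_imp_derivable:
  assumes "equivalent E F"
  shows "derivable Sigma_identities (E, F)"
proof -
  let ?nf = "\<lambda>E. reduce (word_of E)"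
  have nf: "word_value (?nf E) = abs_free_algebra E" for E
    by (simp add: word_value_reduce word_value_word_of)
  have "word_value (?nf E) = word_value (?nf F)"
  proof (rule reduced_word_value_eqI)
    show "class_eval v (word_value (?nf E)) = class_eval v (word_value (?nf F))" for v
      using assms by (simp add: nf class_eval.abs_eq equivalent_iff_mset_eval)
  qed (simp_all add: reduced_reduce)
  then show ?thesis by (simp add: nf free_algebra.abs_eq_iff)
qed

theorem theorem9:
  shows "(\<forall>e \<in> Sigma_identities. satisfied e) \<and>
    (\<forall>E F. equivalent E F \<longrightarrow> derivable Sigma_identities (E, F))"
  using satisfied_Sigma equivalent_imp_derivable by blast

end
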